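(* Let $C$ be an $\Omega$-space and let $C^\delta$ be its canonical extension with respect to $F\subseteq\mathcal UC$ and $I\subseteq\mathcal DC$. Let $f\in F$ and $i\in I$. Then $$C^\delta\big(\lim\nolimits_f[-],\ \mathrm{colim}_i[-]\big)=\mathbf I(f,i),\qquad\text{where } \mathbf I(f,i)=\bigsqcup_{c\in C} f(c)\cdot i(c),$$ $\lim_f[-]$ is the limit of $[-]:C\to C^\delta$ weighted by $f$, and $\mathrm{colim}_i[-]$ is the colimit of $[-]:C\to C^\delta$ weighted by $i$.
   Context: Quantale: $\Omega=(\Omega,\sqsubseteq,\bigsqcup,e,\cdot)$ is a complete lattice (joins $\bigsqcup$, meets $\bigwedge$) with a monoid structure $(e,\cdot)$, not necessarily commutative, whose multiplication preserves arbitrary joins in each argument. Residuals $\rhd,\lhd$ are defined by $b\sqsubseteq a\rhd c\Leftrightarrow a\cdot b\sqsubseteq c\Leftrightarrow a\sqsubseteq c\lhd b$. $\Omega$-space: a set $X$ with $X(-,-):X\times X\to\Omega$ such that $e\sqsubseteq X(x,x)$ and $X(x,y)\cdot X(y,z)\sqsubseteq X(x,z)$. A functor $G:X\to Y$ is a map with $X(x,x')\sqsubseteq Y(Gx,Gx')$. $\mathcal DX$ (weighted downsets, presheaves): functions $\phi:X\to\Omega$ with $X(x',x)\cdot\phi(x)\sqsubseteq\phi(x')$. $\mathcal UX$ (weighted upsets, co-presheaves): functions $\psi:X\to\Omega$ with $\psi(x)\cdot X(x,x')\sqsubseteq\psi(x')$. Weighted (co)limits: for a functor $G:X\to B$, the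 colimit of $G$ weighted by $\phi\in\mathcal DX$ is an element $\mathrm{colim}_\phi G\in B$ with $B(\mathrm{colim}_\phi G,b)=\bigwedge_{x}\phi(x)\rhd B(Gx,b)$ for all $b\in B$; the limit weighted by $\psi\in\mathcal UX$ is an element $\lim_\psi G\in B$ with $B(b,\lim_\psi G)=\bigwedge_x B(b,Gx)\lhd\psi(x)$ for all $b\in B$. Canonical extension: let $F\subseteq\mathcal UC$ and $I\subseteq\mathcal DC$ be subsets which (standing assumption) contain all representables, i.e. $C(c,-)\in F$ and $C(-,c)\in I$ for all $c\in C$. Put $\mathbf I(f,i)=\bigsqcup_{c}f(c)\cdot i(c)$ for $f\in F,i\in I$. The elements of $C^\delta$ are pairs $\kappa=(\phi_\kappa,\psi_\kappa)$ of functions $\phi_\kappa:F\to\Omega$, $\psi_\kappa:I\to\Omega$ with $\psi_\kappa(i)=\bigwedge_{f\in F}\phi_\kappa(f)\rhd\mathbf I(f,i)$ and $\phi_\kappa(f)=\bigwedge_{i\in I}\mathbf I(f,i)\lhd\psi_\kappa(i)$. The hom is $C^\delta(\kappa,\kappa')=\bigwedge_{f}\phi_\kappa(f)\rhd\phi_{\kappa'}(f)=\bigwedge_i\psi_\kappa(i)\lhd\psi_{\kappa'}(i)$ (the two expressions agree). $C^\delta$ has all weighted limits and colimits. The functor $[-]:C\to C^\delta$ is given by $\phi_{[c]}(f)=f(c)$, $\psi_{[c]}(i)=i(c)$. *)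

theory Defs
  imports "HOL-Library.FuncSet"
begin

text \<open>
  A quantale: the unit \<open>e\<close> is \<open>1\<close>, the (possibly non-commutative) multiplication is \<open>(*)\<close>,
  and the order is \<open>(\<le>)\<close>.
\<close>

class quantale = complete_lattice + monoid_mult +
  assumes Sup_mult_distrib: "Sup A * b = (SUP a\<in>A. a * b)"
    and mult_Sup_distrib: "a * Sup B = (SUP b\<in>B. a * b)"

definition rres :: "'q::quantale \<Rightarrow> 'q \<Rightarrow> 'q"  (infixr \<open>\<rhd>\<close> 65)
  where "a \<rhd> c = Sup {b. a * b \<le> c}"

definition lres :: "'q::quantale \<Rightarrow> 'q \<Rightarrow> 'q"  (infixl \<open>\<lhd>\<close> 65)
  where "c \<lhd> b = Sup {a. a * b \<le> c}"

lemma quantale_mult_mono: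
  fixes a a' b b' :: "'q::quantale"
  assumes "a \<le> a'" "b \<le> b'"
  shows "a * b \<le> a' * b'"
proof -
  have "a * b \<le> a' * b"
    using Sup_mult_distrib[of "{a, a'}" b] assms(1) by (simp add: sup_absorb2 le_iff_sup)
  also have "\<dots> \<le> a' * b'"
    using mult_Sup_distrib[of a' "{b, b'}"] assms(2) by (simp add: sup_absorb2 le_iff_sup)
  finally show ?thesis .
qed

lemma le_rres_iff: "b \<le> a \<rhd> c \<longleftrightarrow> a * b \<le> c"
proof
  assume "b \<le> a \<rhd> c"
  then have "a * b \<le> a * (a \<rhd> c)"
    by (simp add: quantale_mult_mono)
  also have "\<dots> \<le> c"
    unfolding rres_def mult_Sup_distrib by (rule SUP_least) simp
  finally show "a * b \<le> c" .
qed (simp add: rres_def Sup_upper)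

lemma le_lres_iff: "a \<le> c \<lhd> b \<longleftrightarrow> a * b \<le> c"
proof
  assume "a \<le> c \<lhd> b"
  then have "a * b \<le> (c \<lhd> b) * b"
    by (simp add: quantale_mult_mono)
  also have "\<dots> \<le> c"
    unfolding lres_def Sup_mult_distrib by (rule SUP_least) simp
  finally show "a * b \<le> c" .
qed (simp add: lres_def Sup_upper)

text \<open>
  Spaces have an explicit, possibly empty, carrier. Values of \<open>hom\<close> outside the carrier
  are irrelevant.
\<close>

record ('x, 'q) space_data =
  pts :: "'x set"
  hom :: "'x \<Rightarrow> 'x \<Rightarrow> 'q"

definition omega_space :: "('x, 'q::quantale) space_data \<Rightarrow> bool"
  where "omega_space X \<longleftrightarrow>
    (\<forall>x\<in>pts X. 1 \<le> hom X x x) \<and>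
    (\<forall>x\<in>pts X. \<forall>y\<in>pts X. \<forall>z\<in>pts X. hom X x y * hom X y z \<le> hom X x z)"

definition omega_functor ::
    "('x, 'q::quantale) space_data \<Rightarrow> ('y, 'q) space_data \<Rightarrow> ('x \<Rightarrow> 'y) \<Rightarrow> bool"
  where "omega_functor X Y G \<longleftrightarrow>
    G \<in> pts X \<rightarrow> pts Y \<and>
    (\<forall>x\<in>pts X. \<forall>x'\<in>pts X. hom X x x' \<le> hom Y (G x) (G x'))"

text \<open>
  A function whose domain is a carrier set is represented by its \<open>extensional\<close> (that is,
  \<open>undefined\<close> outside the set) extension to the type, so that equality is equality of
  functions on the carrier.
\<close>

definition downsets :: "('x, 'q::quantale) space_data \<Rightarrow> ('x \<Rightarrow> 'q) set"
  where "downsets X = {\<phi> \<in> extensional (pts X).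
    \<forall>x\<in>pts X. \<forall>x'\<in>pts X. hom X x' x * \<phi> x \<le> \<phi> x'}"

definition upsets :: "('x, 'q::quantale) space_data \<Rightarrow> ('x \<Rightarrow> 'q) set"
  where "upsets X = {\<psi> \<in> extensional (pts X).
    \<forall>x\<in>pts X. \<forall>x'\<in>pts X. \<psi> x * hom X x x' \<le> \<psi> x'}"

text \<open>
  Weighted (co)limits in a general space are determined only up to isomorphism, so they are
  given as predicates on the candidate element.
\<close>

definition is_wcolim ::
    "('x, 'q::quantale) space_data \<Rightarrow> ('y, 'q) space_data \<Rightarrow> ('x \<Rightarrow> 'q) \<Rightarrow> ('x \<Rightarrow> 'y) \<Rightarrow> 'y \<Rightarrow> bool"
  where "is_wcolim X B \<phi> G m \<longleftrightarrow>
    omega_functor X B G \<and> \<phi> \<in> downsets X \<and> m \<in> pts B \<and>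
    (\<forall>b\<in>pts B. hom B m b = (INF x\<in>pts X. \<phi> x \<rhd> hom B (G x) b))"

definition is_wlim ::
    "('x, 'q::quantale) space_data \<Rightarrow> ('y, 'q) space_data \<Rightarrow> ('x \<Rightarrow> 'q) \<Rightarrow> ('x \<Rightarrow> 'y) \<Rightarrow> 'y \<Rightarrow> bool"
  where "is_wlim X B \<psi> G l \<longleftrightarrow>
    omega_functor X B G \<and> \<psi> \<in> upsets X \<and> l \<in> pts B \<and>
    (\<forall>b\<in>pts B. hom B b l = (INF x\<in>pts X. hom B b (G x) \<lhd> \<psi> x))"

definition copair :: "('c, 'q::quantale) space_data \<Rightarrow> ('c \<Rightarrow> 'q) \<Rightarrow> ('c \<Rightarrow> 'q) \<Rightarrow> 'q"
  where "copair C f i = (SUP c\<in>pts C. f c * i c)"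

type_synonym ('c, 'q) canext_pt = "(('c \<Rightarrow> 'q) \<Rightarrow> 'q) \<times> (('c \<Rightarrow> 'q) \<Rightarrow> 'q)"

definition canext ::
    "('c, 'q::quantale) space_data \<Rightarrow> ('c \<Rightarrow> 'q) set \<Rightarrow> ('c \<Rightarrow> 'q) set
      \<Rightarrow> (('c, 'q) canext_pt, 'q) space_data"
  where "canext C F I =
    \<lparr> pts = {(\<phi>, \<psi>). \<phi> \<in> extensional F \<and> \<psi> \<in> extensional I \<and>
        (\<forall>i\<in>I. \<psi> i = (INF f\<in>F. \<phi> f \<rhd> copair C f i)) \<and>
        (\<forall>f\<in>F. \<phi> f = (INF i\<in>I. copair C f i \<lhd> \<psi> i))},
      hom = (\<lambda>\<kappa> \<kappa>'. INF f\<in>F. fst \<kappa> f \<rhd> fst \<kappa>' f) \<rparr>"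

lemma canext_hom_eq_snd:
  assumes "\<kappa> \<in> pts (canext C F I)" "\<kappa>' \<in> pts (canext C F I)"
  shows "hom (canext C F I) \<kappa> \<kappa>' = (INF i\<in>I. snd \<kappa> i \<lhd> snd \<kappa>' i)"
proof -
  obtain \<phi> \<psi> \<phi>' \<psi>' where k: "\<kappa> = (\<phi>, \<psi>)" "\<kappa>' = (\<phi>', \<psi>')"
    by (metis surj_pair)
  have psi: "\<psi> i = (INF f\<in>F. \<phi> f \<rhd> copair C f i)" if "i \<in> I" for i
    using assms(1) that by (auto simp: canext_def k)
  have phi': "\<phi>' f = (INF i\<in>I. copair C f i \<lhd> \<psi>' i)" if "f \<in> F" for f
    using assms(2) that by (auto simp: canext_def k)
  have "a \<le> (INF f\<in>F. \<phi> f \<rhd> \<phi>' f) \<longleftrightarrow> a \<le> (INF i\<in>I. \<psi> i \<lhd> \<psi>' i)" for a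
    by (auto simp: le_INF_iff le_rres_iff le_lres_iff psi phi' mult.assoc)
  then have "(INF f\<in>F. \<phi> f \<rhd> \<phi>' f) = (INF i\<in>I. \<psi> i \<lhd> \<psi>' i)"
    by (metis order.refl order.antisym)
  then show ?thesis
    by (simp add: canext_def k)
qed

definition canext_emb :: "('c \<Rightarrow> 'q) set \<Rightarrow> ('c \<Rightarrow> 'q) set \<Rightarrow> 'c \<Rightarrow> ('c, 'q::quantale) canext_pt"
  where "canext_emb F I c = (\<lambda>f\<in>F. f c, \<lambda>i\<in>I. i c)"

end

theory Submission
  imports Defs
begin

text \<open>
  The limit and the colimit have explicit representatives. The colimit of \<open>[-]\<close> weighted by
  \<open>i\<close> has first component \<open>\<phi>(f') = I(f', i)\<close>, and the limit weighted by \<open>f\<close> has second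
  component \<open>\<psi>(i') = I(f, i')\<close>; in both cases the other component is forced by the Galois
  connection that defines the canonical extension
  (\<open>canext_colim_in_pts\<close>, \<open>canext_lim_in_pts\<close>). Their universal properties reduce to the
  fact that a residual turns the join \<open>I(f', i) = \<Squnion>\<^sub>c f'(c) \<cdot> i(c)\<close> into a meet and a product
  into an iterated residual (\<open>is_wcolim_canext_colim\<close>, \<open>is_wlim_canext_lim\<close>). The
  representables enter only through a Yoneda argument placing \<open>[c]\<close> in the extension.

  Writing \<open>l\<close> and \<open>m\<close> for these points, the second formula for the hom gives
  \<open>hom(l, m) = \<Sqinter>\<^sub>i\<^sub>' I(f, i') \<lhd> \<psi>\<^sub>m(i')\<close>, and this is \<open>\<phi>\<^sub>m(f) = I(f, i)\<close>, because \<open>m\<close> is a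
  point of the extension (\<open>hom_canext_lim\<close>). Finally, the canonical extension is a
  separated space, so the limit and the colimit are unique and the formula holds for every
  choice of them (\<open>canext_separated\<close>).
\<close>

section \<open>Residuals and the copairing\<close>

lemma eq_iff_same_lower_bounds:
  fixes a b :: "'a::order"
  assumes "\<And>x. x \<le> a \<longleftrightarrow> x \<le> b"
  shows "a = b"
  using assms by (metis order.refl order.antisym)

lemma one_le_rres_iff: "1 \<le> a \<rhd> b \<longleftrightarrow> a \<le> b"
  by (simp add: le_rres_iff)

lemma rres_le_if_one_le: "1 \<le> a \<Longrightarrow> a \<rhd> b \<le> b"
  by (metis le_rres_iff mult_1 order.refl order.trans quantale_mult_mono)

lemma lres_le_if_one_le: "1 \<le> a \<Longrightarrow> b \<lhd> a \<le> b"
  by (metis le_lres_iff mult_1_right order.refl order.trans quantale_mult_mono)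

lemma copair_mult_le_iff:
  "copair C f i * a \<le> b \<longleftrightarrow> (\<forall>c\<in>pts C. f c * (i c * a) \<le> b)"
  by (simp add: copair_def Sup_mult_distrib SUP_le_iff mult.assoc)

lemma mult_copair_le_iff:
  "a * copair C f i \<le> b \<longleftrightarrow> (\<forall>c\<in>pts C. a * f c * i c \<le> b)"
  by (simp add: copair_def mult_Sup_distrib SUP_le_iff mult.assoc)

lemma mult_le_copair: "c \<in> pts C \<Longrightarrow> f c * i c \<le> copair C f i"
  unfolding copair_def by (rule SUP_upper)

lemma copair_hom_left:
  assumes "omega_space C" "i \<in> downsets C" "c \<in> pts C"
  shows "copair C (\<lambda>x\<in>pts C. hom C c x) i = i c"
proof (rule order.antisym)
  show "copair C (\<lambda>x\<in>pts C. hom C c x) i \<le> i c"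
    using assms by (auto simp: copair_def downsets_def intro!: SUP_least)
  have "1 * i c \<le> hom C c c * i c"
    using assms by (intro quantale_mult_mono) (auto simp: omega_space_def)
  also have "\<dots> \<le> copair C (\<lambda>x\<in>pts C. hom C c x) i"
    using mult_le_copair[of c C "\<lambda>x\<in>pts C. hom C c x" i] assms(3) by simp
  finally show "i c \<le> copair C (\<lambda>x\<in>pts C. hom C c x) i"
    by simp
qed

lemma copair_hom_right:
  assumes "omega_space C" "f \<in> upsets C" "c \<in> pts C"
  shows "copair C f (\<lambda>x\<in>pts C. hom C x c) = f c"
proof (rule order.antisym)
  show "copair C f (\<lambda>x\<in>pts C. hom C x c) \<le> f c"
    using assms by (auto simp: copair_def upsets_def intro!: SUP_least)
  have "f c * 1 \<le> f c * hom C c c"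
    using assms by (intro quantale_mult_mono) (auto simp: omega_space_def)
  also have "\<dots> \<le> copair C f (\<lambda>x\<in>pts C. hom C x c)"
    using mult_le_copair[of c C f "\<lambda>x\<in>pts C. hom C x c"] assms(3) by simp
  finally show "f c \<le> copair C f (\<lambda>x\<in>pts C. hom C x c)"
    by simp
qed

section \<open>The canonical extension as a separated space\<close>

lemma in_pts_canext_iff:
  "\<kappa> \<in> pts (canext C F I) \<longleftrightarrow>
    fst \<kappa> \<in> extensional F \<and> snd \<kappa> \<in> extensional I \<and>
    (\<forall>i\<in>I. snd \<kappa> i = (INF f\<in>F. fst \<kappa> f \<rhd> copair C f i)) \<and>
    (\<forall>f\<in>F. fst \<kappa> f = (INF i\<in>I. copair C f i \<lhd> snd \<kappa> i))"
  by (cases \<kappa>) (simp add: canext_def)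

lemma hom_canext: "hom (canext C F I) \<kappa> \<kappa>' = (INF f\<in>F. fst \<kappa> f \<rhd> fst \<kappa>' f)"
  by (simp add: canext_def)

lemma one_le_hom_canext_iff:
  "1 \<le> hom (canext C F I) \<kappa> \<kappa>' \<longleftrightarrow> (\<forall>f\<in>F. fst \<kappa> f \<le> fst \<kappa>' f)"
  by (simp add: hom_canext le_INF_iff one_le_rres_iff)

text \<open>
  A point of the extension is determined by its first component, and the relation
  \<open>1 \<le> hom \<kappa> \<kappa>'\<close> is the pointwise order of first components.
\<close>

lemma canext_separated:
  assumes "\<kappa> \<in> pts (canext C F I)" "\<kappa>' \<in> pts (canext C F I)"
    and "1 \<le> hom (canext C F I) \<kappa> \<kappa>'" "1 \<le> hom (canext C F I) \<kappa>' \<kappa>"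
  shows "\<kappa> = \<kappa>'"
proof (rule prod_eqI)
  have eq: "fst \<kappa> f = fst \<kappa>' f" if "f \<in> F" for f
    using assms(3,4) that by (auto simp: one_le_hom_canext_iff intro: order.antisym)
  show "fst \<kappa> = fst \<kappa>'"
  proof (rule extensionalityI)
    show "fst \<kappa> \<in> extensional F" "fst \<kappa>' \<in> extensional F"
      using assms(1,2) by (simp_all only: in_pts_canext_iff)
  qed (rule eq)
  show "snd \<kappa> = snd \<kappa>'"
  proof (rule extensionalityI)
    show "snd \<kappa> \<in> extensional I" "snd \<kappa>' \<in> extensional I"
      using assms(1,2) by (simp_all only: in_pts_canext_iff)
    fix i assume i: "i \<in> I"
    have "snd \<kappa> i = (INF f\<in>F. fst \<kappa> f \<rhd> copair C f i)"
      using assms(1) i unfolding in_pts_canext_iff by blast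
    also have "\<dots> = (INF f\<in>F. fst \<kappa>' f \<rhd> copair C f i)"
      using eq by (intro INF_cong) simp_all
    also have "\<dots> = snd \<kappa>' i"
      using assms(2) i unfolding in_pts_canext_iff by metis
    finally show "snd \<kappa> i = snd \<kappa>' i" .
  qed
qed

lemma one_le_hom_canext_refl: "1 \<le> hom (canext C F I) \<kappa> \<kappa>"
  by (simp add: one_le_hom_canext_iff)

lemma is_wlim_canext_unique:
  assumes "is_wlim X (canext C F I) \<psi> G l" "is_wlim X (canext C F I) \<psi> G l'"
  shows "l = l'"
proof -
  have "hom (canext C F I) b l = hom (canext C F I) b l'" if "b \<in> pts (canext C F I)" for b
    using assms that by (simp add: is_wlim_def)
  moreover have "l \<in> pts (canext C F I)" "l' \<in> pts (canext C F I)"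
    using assms by (auto simp: is_wlim_def)
  ultimately show ?thesis
    by (metis canext_separated one_le_hom_canext_refl)
qed

lemma is_wcolim_canext_unique:
  assumes "is_wcolim X (canext C F I) \<phi> G m" "is_wcolim X (canext C F I) \<phi> G m'"
  shows "m = m'"
proof -
  have "hom (canext C F I) m b = hom (canext C F I) m' b" if "b \<in> pts (canext C F I)" for b
    using assms that by (simp add: is_wcolim_def)
  moreover have "m \<in> pts (canext C F I)" "m' \<in> pts (canext C F I)"
    using assms by (auto simp: is_wcolim_def)
  ultimately show ?thesis
    by (metis canext_separated one_le_hom_canext_refl)
qed

section \<open>The embedding\<close>

lemma fst_canext_emb: "f \<in> F \<Longrightarrow> fst (canext_emb F I c) f = f c"
  by (simp add: canext_emb_def)

lemma snd_canext_emb: "i \<in> I \<Longrightarrow> snd (canext_emb F I c) i = i c"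
  by (simp add: canext_emb_def)

text \<open>
  Each of the two Galois equations for \<open>[c]\<close> is a Yoneda argument: the meet is attained
  at the representable of \<open>c\<close>, where the copairing evaluates the other argument at \<open>c\<close>.
\<close>

lemma canext_emb_in_pts:
  assumes C: "omega_space C" and F: "F \<subseteq> upsets C" and I: "I \<subseteq> downsets C"
    and c: "c \<in> pts C"
    and rF: "(\<lambda>x\<in>pts C. hom C c x) \<in> F" and rI: "(\<lambda>x\<in>pts C. hom C x c) \<in> I"
  shows "canext_emb F I c \<in> pts (canext C F I)"
proof -
  have one: "1 \<le> hom C c c"
    using C c by (simp add: omega_space_def)
  have "i c = (INF f\<in>F. f c \<rhd> copair C f i)" if i: "i \<in> I" for i
  proof (rule order.antisym)
    show "i c \<le> (INF f\<in>F. f c \<rhd> copair C f i)"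
      using c by (auto simp: le_INF_iff le_rres_iff mult_le_copair)
    have "(INF f\<in>F. f c \<rhd> copair C f i) \<le> hom C c c \<rhd> i c"
      using INF_lower[OF rF, of "\<lambda>f. f c \<rhd> copair C f i"] copair_hom_left[OF C _ c, of i] I i c
      by auto
    also have "\<dots> \<le> i c"
      by (rule rres_le_if_one_le[OF one])
    finally show "(INF f\<in>F. f c \<rhd> copair C f i) \<le> i c" .
  qed
  moreover have "f c = (INF i\<in>I. copair C f i \<lhd> i c)" if f: "f \<in> F" for f
  proof (rule order.antisym)
    show "f c \<le> (INF i\<in>I. copair C f i \<lhd> i c)"
      using c by (auto simp: le_INF_iff le_lres_iff mult_le_copair)
    have "(INF i\<in>I. copair C f i \<lhd> i c) \<le> f c \<lhd> hom C c c"
      using INF_lower[OF rI, of "\<lambda>i. copair C f i \<lhd> i c"] copair_hom_right[OF C _ c, of f] F f c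
      by auto
    also have "\<dots> \<le> f c"
      by (rule lres_le_if_one_le[OF one])
    finally show "(INF i\<in>I. copair C f i \<lhd> i c) \<le> f c" .
  qed
  ultimately show ?thesis
    by (simp add: in_pts_canext_iff canext_emb_def)
qed

lemma omega_functor_canext_emb:
  assumes "F \<subseteq> upsets C"
    and "\<And>c. c \<in> pts C \<Longrightarrow> canext_emb F I c \<in> pts (canext C F I)"
  shows "omega_functor C (canext C F I) (canext_emb F I)"
  using assms
  by (auto simp: omega_functor_def hom_canext fst_canext_emb le_INF_iff le_rres_iff upsets_def)

section \<open>Explicit weighted limits and colimits\<close>

definition canext_lim ::
    "('c, 'q::quantale) space_data \<Rightarrow> ('c \<Rightarrow> 'q) set \<Rightarrow> ('c \<Rightarrow> 'q) set \<Rightarrow> ('c \<Rightarrow> 'q)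
      \<Rightarrow> ('c, 'q) canext_pt"
  where "canext_lim C F I f =
    (\<lambda>f'\<in>F. INF i\<in>I. copair C f' i \<lhd> copair C f i, \<lambda>i\<in>I. copair C f i)"

definition canext_colim ::
    "('c, 'q::quantale) space_data \<Rightarrow> ('c \<Rightarrow> 'q) set \<Rightarrow> ('c \<Rightarrow> 'q) set \<Rightarrow> ('c \<Rightarrow> 'q)
      \<Rightarrow> ('c, 'q) canext_pt"
  where "canext_colim C F I i =
    (\<lambda>f\<in>F. copair C f i, \<lambda>i'\<in>I. INF f\<in>F. copair C f i \<rhd> copair C f i')"

lemma snd_canext_lim: "i \<in> I \<Longrightarrow> snd (canext_lim C F I f) i = copair C f i"
  by (simp add: canext_lim_def)

lemma fst_canext_colim: "f \<in> F \<Longrightarrow> fst (canext_colim C F I i) f = copair C f i"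
  by (simp add: canext_colim_def)

text \<open>
  The first component is defined from the second, so only the equation for the second
  component has content. That \<open>I(f, i)\<close> lies below the meet is the unit of the Galois
  connection. Conversely, since \<open>f \<in> F\<close>, the meet includes the term at \<open>f\<close>; there the
  first component is at least \<open>1\<close>, so the term is at most \<open>I(f, i)\<close>. The colimit is dual.
\<close>

lemma canext_lim_in_pts:
  assumes f: "f \<in> F"
  shows "canext_lim C F I f \<in> pts (canext C F I)"
proof -
  let ?\<phi> = "\<lambda>f'. INF i\<in>I. copair C f' i \<lhd> copair C f i"
  have "(INF f'\<in>F. ?\<phi> f' \<rhd> copair C f' i) = copair C f i" if i: "i \<in> I" for i
  proof (rule order.antisym)
    have "?\<phi> f' * copair C f i \<le> copair C f' i" for f'
      using INF_lower[OF i, of "\<lambda>i. copair C f' i \<lhd> copair C f i"] by (simp add: le_lres_iff)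
    then show "copair C f i \<le> (INF f'\<in>F. ?\<phi> f' \<rhd> copair C f' i)"
      by (simp add: le_INF_iff le_rres_iff)
    have "1 \<le> ?\<phi> f"
      by (simp add: le_INF_iff le_lres_iff)
    then have "?\<phi> f \<rhd> copair C f i \<le> copair C f i"
      by (rule rres_le_if_one_le)
    then show "(INF f'\<in>F. ?\<phi> f' \<rhd> copair C f' i) \<le> copair C f i"
      by (rule INF_lower2[OF f])
  qed
  then show ?thesis
    by (simp add: in_pts_canext_iff canext_lim_def)
qed

lemma canext_colim_in_pts:
  assumes i: "i \<in> I"
  shows "canext_colim C F I i \<in> pts (canext C F I)"
proof -
  let ?\<psi> = "\<lambda>i'. INF f\<in>F. copair C f i \<rhd> copair C f i'"
  have "(INF i'\<in>I. copair C f i' \<lhd> ?\<psi> i') = copair C f i" if f: "f \<in> F" for f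
  proof (rule order.antisym)
    have "copair C f i * ?\<psi> i' \<le> copair C f i'" for i'
      using INF_lower[OF f, of "\<lambda>f. copair C f i \<rhd> copair C f i'"] by (simp add: le_rres_iff)
    then show "copair C f i \<le> (INF i'\<in>I. copair C f i' \<lhd> ?\<psi> i')"
      by (simp add: le_INF_iff le_lres_iff)
    have "1 \<le> ?\<psi> i"
      by (simp add: le_INF_iff le_rres_iff)
    then have "copair C f i \<lhd> ?\<psi> i \<le> copair C f i"
      by (rule lres_le_if_one_le)
    then show "(INF i'\<in>I. copair C f i' \<lhd> ?\<psi> i') \<le> copair C f i"
      by (rule INF_lower2[OF i])
  qed
  then show ?thesis
    by (simp add: in_pts_canext_iff canext_colim_def)
qed

text \<open>
  The universal property of the limit needs the description of the hom by second
  components, since only there does \<open>canext_lim\<close> have a formula without residuals.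
\<close>

lemma is_wlim_canext_lim:
  assumes G: "omega_functor C (canext C F I) (canext_emb F I)"
    and f: "f \<in> F" "f \<in> upsets C"
  shows "is_wlim C (canext C F I) f (canext_emb F I) (canext_lim C F I f)"
proof -
  note l = canext_lim_in_pts[OF f(1), of C I]
  have emb: "canext_emb F I c \<in> pts (canext C F I)" if "c \<in> pts C" for c
    using G that by (auto simp: omega_functor_def)
  have "hom (canext C F I) b (canext_lim C F I f) =
      (INF c\<in>pts C. hom (canext C F I) b (canext_emb F I c) \<lhd> f c)"
    if b: "b \<in> pts (canext C F I)" for b
  proof (rule eq_iff_same_lower_bounds)
    fix a
    have "a \<le> hom (canext C F I) b (canext_lim C F I f) \<longleftrightarrow>
        (\<forall>i\<in>I. \<forall>c\<in>pts C. a * f c * i c \<le> snd b i)"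
      by (simp add: canext_hom_eq_snd[OF b l] snd_canext_lim le_INF_iff le_lres_iff
          mult_copair_le_iff)
    also have "\<dots> \<longleftrightarrow> (\<forall>c\<in>pts C. a * f c \<le> hom (canext C F I) b (canext_emb F I c))"
      by (auto simp: canext_hom_eq_snd[OF b emb] snd_canext_emb le_INF_iff le_lres_iff)
    also have "\<dots> \<longleftrightarrow> a \<le> (INF c\<in>pts C. hom (canext C F I) b (canext_emb F I c) \<lhd> f c)"
      by (simp add: le_INF_iff le_lres_iff)
    finally show "a \<le> hom (canext C F I) b (canext_lim C F I f) \<longleftrightarrow>
        a \<le> (INF c\<in>pts C. hom (canext C F I) b (canext_emb F I c) \<lhd> f c)" .
  qed
  then show ?thesis
    using G f l by (simp add: is_wlim_def)
qed

lemma is_wcolim_canext_colim: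
  assumes G: "omega_functor C (canext C F I) (canext_emb F I)"
    and i: "i \<in> I" "i \<in> downsets C"
  shows "is_wcolim C (canext C F I) i (canext_emb F I) (canext_colim C F I i)"
proof -
  have "hom (canext C F I) (canext_colim C F I i) b =
      (INF c\<in>pts C. i c \<rhd> hom (canext C F I) (canext_emb F I c) b)" for b
  proof (rule eq_iff_same_lower_bounds)
    fix a
    have "a \<le> hom (canext C F I) (canext_colim C F I i) b \<longleftrightarrow>
        (\<forall>f\<in>F. \<forall>c\<in>pts C. f c * (i c * a) \<le> fst b f)"
      by (simp add: hom_canext fst_canext_colim le_INF_iff le_rres_iff copair_mult_le_iff)
    also have "\<dots> \<longleftrightarrow> a \<le> (INF c\<in>pts C. i c \<rhd> hom (canext C F I) (canext_emb F I c) b)"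
      by (auto simp: hom_canext fst_canext_emb le_INF_iff le_rres_iff)
    finally show "a \<le> hom (canext C F I) (canext_colim C F I i) b \<longleftrightarrow>
        a \<le> (INF c\<in>pts C. i c \<rhd> hom (canext C F I) (canext_emb F I c) b)" .
  qed
  then show ?thesis
    using G i canext_colim_in_pts[OF i(1), of C F] by (simp add: is_wcolim_def)
qed

text \<open>
  Computed by second components, the hom out of the limit is \<open>\<Sqinter>\<^sub>i I(f, i) \<lhd> \<psi>\<^sub>\<kappa>(i)\<close>, which is
  the Galois equation for \<open>\<phi>\<^sub>\<kappa>(f)\<close>: evaluation at \<open>f\<close> is represented by the limit
  weighted by \<open>f\<close>.
\<close>

lemma hom_canext_lim:
  assumes "f \<in> F" "\<kappa> \<in> pts (canext C F I)"
  shows "hom (canext C F I) (canext_lim C F I f) \<kappa> = fst \<kappa> f"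
proof -
  have "hom (canext C F I) (canext_lim C F I f) \<kappa> = (INF i\<in>I. copair C f i \<lhd> snd \<kappa> i)"
    by (simp add: canext_hom_eq_snd[OF canext_lim_in_pts[OF assms(1)] assms(2)] snd_canext_lim)
  also have "\<dots> = fst \<kappa> f"
    using assms by (simp add: in_pts_canext_iff)
  finally show ?thesis .
qed

section \<open>The hom from the limit to the colimit\<close>

theorem theorem4p12:
  fixes C :: "('c, 'q::quantale) space_data"
    and F I :: "('c \<Rightarrow> 'q) set"
    and f i :: "'c \<Rightarrow> 'q"
  assumes "omega_space C"
    and "F \<subseteq> upsets C"
    and "I \<subseteq> downsets C"
    and "\<And>c. c \<in> pts C \<Longrightarrow> (\<lambda>x\<in>pts C. hom C c x) \<in> F"
    and "\<And>c. c \<in> pts C \<Longrightarrow> (\<lambda>x\<in>pts C. hom C x c) \<in> I"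
    and "f \<in> F"
    and "i \<in> I"
  shows "(\<exists>l. is_wlim C (canext C F I) f (canext_emb F I) l) \<and>
    (\<exists>m. is_wcolim C (canext C F I) i (canext_emb F I) m) \<and>
    (\<forall>l m. is_wlim C (canext C F I) f (canext_emb F I) l \<longrightarrow>
           is_wcolim C (canext C F I) i (canext_emb F I) m \<longrightarrow>
           hom (canext C F I) l m = copair C f i)"
proof -
  let ?D = "canext C F I" and ?E = "canext_emb F I"
  have G: "omega_functor C ?D ?E"
    by (rule omega_functor_canext_emb[OF assms(2)])
      (rule canext_emb_in_pts[OF assms(1-3) _ assms(4,5)])
  have l: "is_wlim C ?D f ?E (canext_lim C F I f)"
    using is_wlim_canext_lim[OF G] assms by blast
  have m: "is_wcolim C ?D i ?E (canext_colim C F I i)"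
    using is_wcolim_canext_colim[OF G] assms by blast
  have "hom ?D (canext_lim C F I f) (canext_colim C F I i) = copair C f i"
    using hom_canext_lim[OF assms(6) canext_colim_in_pts[OF assms(7)]] assms(6)
    by (simp add: fst_canext_colim)
  then show ?thesis
    using l m is_wlim_canext_unique is_wcolim_canext_unique by blast
qed

end
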